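(* Let $G$ be a connected graph with at least two vertices and total domination number $\gamma_t(G)$. Then $\chi_{\rm pcf}(G)\le\gamma_t(G)+\chi(G)$.
   Context: All graphs are simple, finite and undirected. A vertex coloring of a graph is proper if adjacent vertices get distinct colors. It is conflict-free (with respect to open neighborhoods) if for every non-isolated vertex $x$ there is a color that appears exactly once on the open neighborhood $N(x)$. A PCF $k$-coloring is a vertex coloring with at most $k$ colors that is both proper and conflict-free. The PCF chromatic number $\chi_{\rm pcf}(G)$ is the minimum $k$ for which $G$ admits a PCF $k$-coloring; $\chi(G)$ is the chromatic number. A set $D\subseteq V(G)$ is a total dominating set if every vertex of $G$ has a neighbor in $D$; $\gamma_t(G)$ is the minimum cardinality of a total dominating set. *)

theory Defs
  imports "Graph_Theory.Digraph_Component"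
begin

(* Finite simple undirected graphs are the library's locale "graph": finite, loop-free, symmetric
   digraphs without parallel arcs.  An undirected edge {u, v} is the pair of arcs u -> v, v -> u,
   so adjacency is the relation u \<rightarrow>\<^bsub>G\<^esub> v. *)

definition open_nbhd :: "('a, 'b) pre_digraph \<Rightarrow> 'a \<Rightarrow> 'a set" where
  "open_nbhd G x = {y. x \<rightarrow>\<^bsub>G\<^esub> y}"

definition proper_coloring :: "('a, 'b) pre_digraph \<Rightarrow> ('a \<Rightarrow> nat) \<Rightarrow> bool" where
  "proper_coloring G c \<longleftrightarrow>
     (\<forall>u \<in> verts G. \<forall>v \<in> verts G. u \<rightarrow>\<^bsub>G\<^esub> v \<longrightarrow> c u \<noteq> c v)"

definition conflict_free_coloring :: "('a, 'b) pre_digraph \<Rightarrow> ('a \<Rightarrow> nat) \<Rightarrow> bool" where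
  "conflict_free_coloring G c \<longleftrightarrow>
     (\<forall>x \<in> verts G. open_nbhd G x \<noteq> {} \<longrightarrow>
        (\<exists>a. card {y \<in> open_nbhd G x. c y = a} = 1))"

definition proper_k_coloring :: "('a, 'b) pre_digraph \<Rightarrow> nat \<Rightarrow> ('a \<Rightarrow> nat) \<Rightarrow> bool" where
  "proper_k_coloring G k c \<longleftrightarrow> proper_coloring G c \<and> card (c ` verts G) \<le> k"

definition pcf_k_coloring :: "('a, 'b) pre_digraph \<Rightarrow> nat \<Rightarrow> ('a \<Rightarrow> nat) \<Rightarrow> bool" where
  "pcf_k_coloring G k c \<longleftrightarrow>
     proper_coloring G c \<and> conflict_free_coloring G c \<and> card (c ` verts G) \<le> k"

definition chromatic_number :: "('a, 'b) pre_digraph \<Rightarrow> nat" where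
  "chromatic_number G = (LEAST k. \<exists>c. proper_k_coloring G k c)"

definition pcf_chromatic_number :: "('a, 'b) pre_digraph \<Rightarrow> nat" where
  "pcf_chromatic_number G = (LEAST k. \<exists>c. pcf_k_coloring G k c)"

definition total_dominating_set :: "('a, 'b) pre_digraph \<Rightarrow> 'a set \<Rightarrow> bool" where
  "total_dominating_set G D \<longleftrightarrow>
     D \<subseteq> verts G \<and> (\<forall>x \<in> verts G. open_nbhd G x \<inter> D \<noteq> {})"

(* Only meaningful without isolated vertices; otherwise no total dominating set exists. *)
definition total_domination_number :: "('a, 'b) pre_digraph \<Rightarrow> nat" where
  "total_domination_number G = (LEAST n. \<exists>D. total_dominating_set G D \<and> card D = n)"

(* The three minima are attained, so LEAST is never applied to an unsatisfiable predicate
   in the situations of interest. *)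

lemma ex_pcf_k_coloring:
  assumes "graph G"
  shows "\<exists>k c. pcf_k_coloring G k c"
proof -
  interpret graph G by fact
  obtain c :: "'a \<Rightarrow> nat" where c: "inj_on c (verts G)"
    using finite_verts finite_imp_inj_to_nat_seg by blast
  have arcD: "u \<in> verts G \<and> v \<in> verts G \<and> u \<noteq> v" if "u \<rightarrow>\<^bsub>G\<^esub> v" for u v
  proof -
    from that obtain e where "e \<in> arcs G" "tail G e = u" "head G e = v" by (rule reachableE)
    then show ?thesis using tail_in_verts head_in_verts no_loops by metis
  qed
  have "proper_coloring G c"
    unfolding proper_coloring_def
  proof (intro ballI impI)
    fix u v assume "u \<rightarrow>\<^bsub>G\<^esub> v"
    from arcD[OF this] show "c u \<noteq> c v" by (simp add: inj_on_eq_iff[OF c])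
  qed
  moreover have "\<exists>a. card {y \<in> open_nbhd G x. c y = a} = 1" if nonempty: "open_nbhd G x \<noteq> {}" for x
  proof -
    obtain z where z: "z \<in> open_nbhd G x" using nonempty by blast
    have "y = z" if "y \<in> open_nbhd G x" "c y = c z" for y
    proof (rule inj_onD[OF c that(2)])
      show "y \<in> verts G" "z \<in> verts G"
        using that(1) z arcD[of x y] arcD[of x z] by (simp_all add: open_nbhd_def)
    qed
    with z have "{y \<in> open_nbhd G x. c y = c z} = {z}" by blast
    then show ?thesis by (intro exI[of _ "c z"]) simp
  qed
  ultimately show ?thesis
    unfolding pcf_k_coloring_def conflict_free_coloring_def by blast
qed

lemma pcf_chromatic_number_attained:
  assumes "graph G"
  shows "\<exists>c. pcf_k_coloring G (pcf_chromatic_number G) c"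
  using LeastI_ex[OF ex_pcf_k_coloring[OF assms]] unfolding pcf_chromatic_number_def .

lemma chromatic_number_attained:
  assumes "graph G"
  shows "\<exists>c. proper_k_coloring G (chromatic_number G) c"
proof -
  have "\<exists>k c. proper_k_coloring G k c"
    using ex_pcf_k_coloring[OF assms] unfolding pcf_k_coloring_def proper_k_coloring_def by blast
  from LeastI_ex[OF this] show ?thesis unfolding chromatic_number_def .
qed

lemma total_domination_number_attained:
  assumes "graph G" and no_isolated: "\<And>x. x \<in> verts G \<Longrightarrow> open_nbhd G x \<noteq> {}"
  shows "\<exists>D. total_dominating_set G D \<and> card D = total_domination_number G"
proof -
  interpret graph G by fact
  have "open_nbhd G x \<subseteq> verts G" for x
    by (auto simp: open_nbhd_def elim!: reachableE)
  then have "total_dominating_set G (verts G)"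
    using no_isolated unfolding total_dominating_set_def by blast
  then have "\<exists>n D. total_dominating_set G D \<and> card D = n" by blast
  from LeastI_ex[OF this] show ?thesis unfolding total_domination_number_def .
qed

lemma connected_no_isolated:
  assumes "graph G" "connected G" "card (verts G) \<ge> 2" "x \<in> verts G"
  shows "open_nbhd G x \<noteq> {}"
proof -
  interpret graph G by fact
  have "\<not> verts G \<subseteq> {x}"
    using assms(3) card_mono[of "{x}" "verts G"] by auto
  then obtain y where y: "y \<in> verts G" "y \<noteq> x" by blast
  then have "x \<rightarrow>\<^sup>*\<^bsub>mk_symmetric G\<^esub> y"
    using assms(2,4) by (auto simp: connected_def strongly_connected_def)
  then have "(x, y) \<in> (parcs (mk_symmetric G))\<^sup>*"
    unfolding reachable_def by (auto dest: rtrancl_on_rtranclI)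
  then obtain z where "(x, z) \<in> parcs (mk_symmetric G)"
    using y(2) by (cases rule: converse_rtranclE) auto
  then have "x \<rightarrow>\<^bsub>G\<^esub> z \<or> z \<rightarrow>\<^bsub>G\<^esub> x"
    by (auto simp: parcs_mk_symmetric arcs_ends_conv)
  then have "x \<rightarrow>\<^bsub>G\<^esub> z"
    by (blast intro: arcs_ends_symmetric[OF sym_arcs])
  then show ?thesis by (auto simp: open_nbhd_def)
qed

end

theory Submission
  imports Defs
begin

text \<open>Recolouring a total dominating set with pairwise distinct fresh colours keeps a proper
  colouring proper, and every vertex then sees a colour that occurs only once in the whole graph.\<close>

lemma (in graph) pcf_k_coloring_recolor_total_dominating_set:
  assumes D: "total_dominating_set G D" and c: "proper_k_coloring G k c"
  shows "\<exists>c'. pcf_k_coloring G (card D + k) c'"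
proof -
  have DV: "D \<subseteq> verts G" using D by (simp add: total_dominating_set_def)
  then have finD: "finite D" by (rule finite_subset) simp
  then obtain f :: "'a \<Rightarrow> nat" where f: "inj_on f D"
    using finite_imp_inj_to_nat_seg by blast
  \<comment> \<open>Odd colours are the fresh ones.\<close>
  define c' where "c' v = (if v \<in> D then 2 * f v + 1 else 2 * c v)" for v
  \<comment> \<open>Here \<open>u\<close> ranges over everything, not just \<open>D\<close>: inside
    \<open>D\<close> injectivity of \<open>f\<close> decides, outside it an even colour cannot equal
    an odd one.\<close>
  have unique: "u = d" if "d \<in> D" "c' u = c' d" for u d
  proof (cases "u \<in> D")
    case True
    with that show ?thesis using inj_onD[OF f] by (simp add: c'_def)
  next
    case False
    with that show ?thesis unfolding c'_def by (simp, presburger)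
  qed
  have "proper_coloring G c'"
    unfolding proper_coloring_def
  proof (intro ballI impI)
    fix u v assume uv: "u \<in> verts G" "v \<in> verts G" "u \<rightarrow>\<^bsub>G\<^esub> v"
    then have "u \<noteq> v" using adj_not_same by blast
    moreover have "c u \<noteq> c v"
      using c uv by (simp add: proper_k_coloring_def proper_coloring_def)
    \<comment> \<open>If either endpoint lies in \<open>D\<close>, equal colours would force
      \<open>u = v\<close> by \<open>unique\<close>; otherwise both colours are doubled old ones,
      which differ because \<open>c\<close> is proper.\<close>
    ultimately show "c' u \<noteq> c' v"
      using unique[of u v] unique[of v u] by (auto simp: c'_def)
  qed
  moreover have "conflict_free_coloring G c'"
    unfolding conflict_free_coloring_def
  proof (intro ballI impI)
    fix x assume "x \<in> verts G"
    then obtain d where d: "d \<in> open_nbhd G x" "d \<in> D"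
      using D by (auto simp: total_dominating_set_def)
    then have "{y \<in> open_nbhd G x. c' y = c' d} = {d}"
      using unique by blast
    then show "\<exists>a. card {y \<in> open_nbhd G x. c' y = a} = 1"
      by (intro exI[of _ "c' d"]) simp
  qed
  moreover have "card (c' ` verts G) \<le> card D + k"
  proof -
    \<comment> \<open>Odd colours come from \<open>D\<close> only; the even ones lie in the doubled
      palette of \<open>c\<close>, whose size is at most \<open>k\<close>.\<close>
    have "c' ` verts G \<subseteq> c' ` D \<union> (*) 2 ` c ` verts G"
      by (auto simp: c'_def)
    then have "card (c' ` verts G) \<le> card (c' ` D \<union> (*) 2 ` c ` verts G)"
      using finD by (intro card_mono) auto
    also have "\<dots> \<le> card (c' ` D) + card ((*) 2 ` c ` verts G)"
      by (rule card_Un_le)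
    also have "\<dots> \<le> card D + card (c ` verts G)"
      using finD by (intro add_mono card_image_le) auto
    also have "\<dots> \<le> card D + k"
      using c by (simp add: proper_k_coloring_def)
    finally show ?thesis .
  qed
  ultimately show ?thesis unfolding pcf_k_coloring_def by blast
qed

theorem mainTheorem14:
  fixes G :: "('a, 'b) pre_digraph"
  assumes "graph G"
    and "connected G"
    and "card (verts G) \<ge> 2"
  shows "pcf_chromatic_number G \<le> total_domination_number G + chromatic_number G"
proof -
  \<comment> \<open>Connectedness and the second vertex exclude isolated vertices, so a total
    dominating set exists and the minimum is attained.\<close>
  obtain D where "total_dominating_set G D" "card D = total_domination_number G"
    using total_domination_number_attained connected_no_isolated assms by metis
  moreover obtain c where "proper_k_coloring G (chromatic_number G) c"
    using chromatic_number_attained assms(1) by blast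
  \<comment> \<open>With both minima attained, the recolouring witnesses the sum as an admissible
    \<open>k\<close>, and \<open>LEAST\<close> is at most any such \<open>k\<close>.\<close>
  ultimately show ?thesis
    using graph.pcf_k_coloring_recolor_total_dominating_set[OF assms(1)]
    unfolding pcf_chromatic_number_def by (metis Least_le)
qed

end
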